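(* Let $k \geq 0$ be a natural number and let $n \in \{2k+1, 2k+2\}$. A fuzzy set $C$ is fuzzy $n$-c.e. if and only if there are fuzzy c.e. sets $A_1, B_1, A_2, B_2, \dots, A_{k+1}, B_{k+1}$ such that $C = (A_1 \cap \overline{B_1}) \cup (A_2 \cap \overline{B_2}) \cup \dots \cup (A_{k+1} \cap \overline{B_{k+1}})$, and, if $n = 2k+1$, then $B_{k+1} = \emptyset$ (i.e., $B_{k+1}(x) = 0$ for all $x$).
   Context: A fuzzy subset of $\omega$ is a function $A\colon \omega \to [0;1]_{\mathbb{R}}$. Operations: $(A\cup B)(x) = \max\{A(x),B(x)\}$, $(A\cap B)(x) = \min\{A(x),B(x)\}$, $\overline{A}(x) = 1 - A(x)$. $[0;1]_{\mathbb{Q}}$ denotes the rationals in $[0,1]$, coded effectively by natural numbers. A fuzzy set $A$ is (fuzzy) c.e. if there is a computable $f\colon \omega\times\omega\to[0;1]_{\mathbb{Q}}$ with $\lim_s f(x,s) = A(x)$ and $f(x,s+1)\geq f(x,s)$ for all $x,s$. For a total $f\colon \omega\times\omega \to [0;1]_{\mathbb{Q}}$, its $\Sigma$-mind change function $m^f_\Sigma\colon \omega\times\omega \to \{-1,1\}$ is defined by: $m^f_\Sigma(x,0) = 1$; if $m^f_\Sigma(x,s)=1$, then $m^f_\Sigma(x,s+1)=1$ when $f(x,s)\leq f(x,s+1)$ and $m^f_\Sigma(x,s+1)=-1$ when $f(x,s) > f(x,s+1)$; if $m^f_\Sigma(x,s)=-1$, then $m^f_\Sigma(x,s+1)=-1$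 when $f(x,s)\geq f(x,s+1)$ and $m^f_\Sigma(x,s+1)=1$ when $f(x,s)<f(x,s+1)$. A fuzzy set $A$ is fuzzy $n$-c.e. ($n \geq 1$) if there is a computable $f\colon \omega\times\omega \to [0;1]_{\mathbb{Q}}$ such that for all $x$: $\lim_s f(x,s) = A(x)$, $f(x,0) = 0$, and $|\{s \in \omega : m^f_\Sigma(x,s+1) \neq m^f_\Sigma(x,s)\}| \leq n-1$. *)

theory Defs
  imports Complex_Main "HOL-Library.Nat_Bijection"
begin

section \<open>Computable functions\<close>

datatype recf =
    Zero
  | Succ
  | Proj nat
  | Comp recf "recf list"
  | PrimRec recf recf
  | Mu recf

text \<open>
  \<open>rec_eval e xs y\<close>: the partial recursive function denoted by \<open>e\<close> is defined at
  the argument tuple \<open>xs\<close> with value \<open>y\<close>. The recursion argument of \<open>PrimRec\<close> and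
  the search argument of \<open>Mu\<close> come first in the tuple.
\<close>

inductive rec_eval :: "recf \<Rightarrow> nat list \<Rightarrow> nat \<Rightarrow> bool" where
  rec_eval_Zero: "rec_eval Zero xs 0"
| rec_eval_Succ: "rec_eval Succ [x] (Suc x)"
| rec_eval_Proj: "i < length xs \<Longrightarrow> rec_eval (Proj i) xs (xs ! i)"
| rec_eval_Comp: "list_all2 (\<lambda>g y. rec_eval g xs y) gs ys \<Longrightarrow> rec_eval f ys z \<Longrightarrow>
    rec_eval (Comp f gs) xs z"
| rec_eval_PrimRec_0: "rec_eval g xs y \<Longrightarrow> rec_eval (PrimRec g h) (0 # xs) y"
| rec_eval_PrimRec_Suc: "rec_eval (PrimRec g h) (m # xs) r \<Longrightarrow> rec_eval h (m # r # xs) y \<Longrightarrow>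
    rec_eval (PrimRec g h) (Suc m # xs) y"
| rec_eval_Mu: "rec_eval f (y # xs) 0 \<Longrightarrow> (\<And>z. z < y \<Longrightarrow> \<exists>v>0. rec_eval f (z # xs) v) \<Longrightarrow>
    rec_eval (Mu f) xs y"

inductive_cases rec_eval_ZeroE: "rec_eval Zero xs y"
inductive_cases rec_eval_SuccE: "rec_eval Succ xs y"
inductive_cases rec_eval_ProjE: "rec_eval (Proj i) xs y"
inductive_cases rec_eval_CompE: "rec_eval (Comp f gs) xs y"
inductive_cases rec_eval_PrimRec0E: "rec_eval (PrimRec g h) (0 # xs) y"
inductive_cases rec_eval_PrimRecSucE: "rec_eval (PrimRec g h) (Suc m # xs) y"
inductive_cases rec_eval_MuE: "rec_eval (Mu f) xs y"

lemma rec_eval_deterministic: "rec_eval e xs y \<Longrightarrow> rec_eval e xs y' \<Longrightarrow> y = y'"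
proof (induction e xs y arbitrary: y' rule: rec_eval.induct)
  case (rec_eval_Comp xs gs ys f z)
  from rec_eval_Comp.prems obtain ys' where
    ys': "list_all2 (\<lambda>g y. rec_eval g xs y) gs ys'" "rec_eval f ys' y'"
    by (rule rec_eval_CompE)
  have "ys = ys'"
  proof (rule nth_equalityI)
    show "length ys = length ys'"
      using list_all2_lengthD[OF rec_eval_Comp.IH(1)] list_all2_lengthD[OF ys'(1)] by simp
    show "ys ! i = ys' ! i" if "i < length ys" for i
      using list_all2_nthD2[OF rec_eval_Comp.IH(1) that] list_all2_nthD[OF ys'(1), of i]
        list_all2_lengthD[OF rec_eval_Comp.IH(1)] that by simp
  qed
  then show ?case using rec_eval_Comp.IH(2) ys'(2) by simp
next
  case (rec_eval_PrimRec_Suc g h m xs r y)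
  from rec_eval_PrimRec_Suc.prems obtain r' where
    "rec_eval (PrimRec g h) (m # xs) r'" "rec_eval h (m # r' # xs) y'"
    by (rule rec_eval_PrimRecSucE)
  then show ?case using rec_eval_PrimRec_Suc.IH by blast
next
  case (rec_eval_Mu f y xs)
  from rec_eval_Mu.prems have
    y': "rec_eval f (y' # xs) 0" "\<And>z. z < y' \<Longrightarrow> \<exists>v>0. rec_eval f (z # xs) v"
    by (blast elim: rec_eval_MuE)+
  show ?case
  proof (rule linorder_cases[of y y'])
    assume "y < y'"
    then obtain v where "v > 0" "rec_eval f (y # xs) v" using y'(2) by blast
    then show ?thesis using rec_eval_Mu.IH(1)[of v] by simp
  next
    assume "y' < y"
    then obtain v where "v > 0" "\<forall>w. rec_eval f (y' # xs) w \<longrightarrow> v = w"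
      using rec_eval_Mu.IH(2) by blast
    then show ?thesis using y'(1) by blast
  qed
qed (blast elim: rec_eval_ZeroE rec_eval_SuccE rec_eval_ProjE rec_eval_PrimRec0E)+

definition computable2 :: "(nat \<Rightarrow> nat \<Rightarrow> nat) \<Rightarrow> bool" where
  "computable2 f \<longleftrightarrow> (\<exists>e. \<forall>x s. rec_eval e [x, s] (f x s))"

text \<open>The code of a nonnegative rational is the pair of its numerator and denominator in
  lowest terms.\<close>

definition rat_code :: "rat \<Rightarrow> nat" where
  "rat_code q = prod_encode (nat (fst (quotient_of q)), nat (snd (quotient_of q)))"

lemma inj_on_rat_code: "inj_on rat_code {0..1}"
proof (rule inj_onI)
  fix p q :: rat
  assume pq: "p \<in> {0..1}" "q \<in> {0..1}" "rat_code p = rat_code q"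
  have nonneg: "fst (quotient_of r) \<ge> 0" if "r \<in> {0..1}" for r :: rat
  proof -
    obtain a b where ab: "quotient_of r = (a, b)" by fastforce
    have "r = of_int a / of_int b" "b > 0"
      using quotient_of_div[OF ab] quotient_of_denom_pos[OF ab] by auto
    then show ?thesis using that ab by (simp add: zero_le_divide_iff)
  qed
  have "quotient_of p = quotient_of q"
    using pq(3) nonneg[OF pq(1)] nonneg[OF pq(2)]
      quotient_of_denom_pos'[of p] quotient_of_denom_pos'[of q]
    by (auto simp: rat_code_def prod_eq_iff eq_nat_nat_iff)
  then show "p = q" by (rule quotient_of_inject)
qed

definition computable_unit_rat :: "(nat \<Rightarrow> nat \<Rightarrow> rat) \<Rightarrow> bool" where
  "computable_unit_rat f \<longleftrightarrow>
    (\<forall>x s. f x s \<in> {0..1}) \<and> computable2 (\<lambda>x s. rat_code (f x s))"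


section \<open>Fuzzy sets\<close>

definition fuzzy_set :: "(nat \<Rightarrow> real) \<Rightarrow> bool" where
  "fuzzy_set A \<longleftrightarrow> (\<forall>x. A x \<in> {0..1})"

definition fuzzy_empty :: "nat \<Rightarrow> real" where
  "fuzzy_empty = (\<lambda>x. 0)"

definition fuzzy_inter :: "(nat \<Rightarrow> real) \<Rightarrow> (nat \<Rightarrow> real) \<Rightarrow> nat \<Rightarrow> real" where
  "fuzzy_inter A B = (\<lambda>x. min (A x) (B x))"

definition fuzzy_compl :: "(nat \<Rightarrow> real) \<Rightarrow> nat \<Rightarrow> real" where
  "fuzzy_compl A = (\<lambda>x. 1 - A x)"

text \<open>The iterated binary union (pointwise maximum) over a finite nonempty index set.\<close>

definition fuzzy_Union :: "nat set \<Rightarrow> (nat \<Rightarrow> nat \<Rightarrow> real) \<Rightarrow> nat \<Rightarrow> real" where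
  "fuzzy_Union I D = (\<lambda>x. Max ((\<lambda>i. D i x) ` I))"

definition fuzzy_ce :: "(nat \<Rightarrow> real) \<Rightarrow> bool" where
  "fuzzy_ce A \<longleftrightarrow> fuzzy_set A \<and>
    (\<exists>f. computable_unit_rat f \<and>
      (\<forall>x. (\<lambda>s. real_of_rat (f x s)) \<longlonglongrightarrow> A x) \<and>
      (\<forall>x s. f x (Suc s) \<ge> f x s))"

primrec mind_change :: "(nat \<Rightarrow> nat \<Rightarrow> rat) \<Rightarrow> nat \<Rightarrow> nat \<Rightarrow> int" where
  "mind_change f x 0 = 1"
| "mind_change f x (Suc s) =
    (if mind_change f x s = 1
     then (if f x s \<le> f x (Suc s) then 1 else -1)
     else (if f x s \<ge> f x (Suc s) then -1 else 1))"

definition fuzzy_nce :: "nat \<Rightarrow> (nat \<Rightarrow> real) \<Rightarrow> bool" where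
  "fuzzy_nce n A \<longleftrightarrow> n \<ge> 1 \<and> fuzzy_set A \<and>
    (\<exists>f. computable_unit_rat f \<and>
      (\<forall>x. (\<lambda>s. real_of_rat (f x s)) \<longlonglongrightarrow> A x \<and>
           f x 0 = 0 \<and>
           finite {s. mind_change f x (Suc s) \<noteq> mind_change f x s} \<and>
           card {s. mind_change f x (Suc s) \<noteq> mind_change f x s} \<le> n - 1))"

end

theory Submission
  imports Defs
begin

text \<open>
  From left to right, split an approximation of \<open>C\<close> at its mind changes: \<open>A\<^sub>i\<close> follows the \<open>i\<close>-th
  increasing phase and jumps to 1 when that phase ends, \<open>B\<^sub>i\<close> follows \<open>1 - f\<close> in the \<open>i\<close>-th
  decreasing phase and then jumps to 1. Only the pair of phases that contains the limit
  contributes to the union.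

  From right to left, take \<open>max\<^sub>i min(a\<^sub>i, 1 - b\<^sub>i)\<close> for monotone approximations \<open>a\<^sub>i, b\<^sub>i\<close>. Each
  \<open>min(a\<^sub>i, 1 - b\<^sub>i)\<close> is quasi-concave, so a term below some earlier term starts a final descent.
  Each downward turn of the maximum puts a further index into its final descent, because during an
  increasing phase the index that attains the maximum is not yet there.

  No gcd is needed for computability: maxima and minima select one of the given codes, and
  \<open>1 - p/q = (q - p)/q\<close> is in lowest terms whenever \<open>p/q\<close> is.
\<close>

section \<open>Closure properties of recursive functions\<close>

text \<open>Only lists of length \<open>n\<close> matter, so \<open>F\<close> may be written with
  \<open>!\<close>, \<open>hd\<close> and \<open>tl\<close> and take any values elsewhere.\<close>

definition recursive :: "nat \<Rightarrow> (nat list \<Rightarrow> nat) \<Rightarrow> bool" where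
  "recursive n F \<longleftrightarrow> (\<exists>e. \<forall>xs. length xs = n \<longrightarrow> rec_eval e xs (F xs))"

definition computable1 :: "(nat \<Rightarrow> nat) \<Rightarrow> bool" where
  "computable1 f \<longleftrightarrow> (\<exists>e. \<forall>x. rec_eval e [x] (f x))"

lemma recursive_cong:
  assumes "recursive n F" "\<And>xs. length xs = n \<Longrightarrow> G xs = F xs"
  shows "recursive n G"
  using assms unfolding recursive_def by metis

lemma recursive_proj: "i < n \<Longrightarrow> recursive n (\<lambda>xs. xs ! i)"
  unfolding recursive_def by (metis rec_eval_Proj)

lemma computable1_comp:
  assumes "computable1 f" "recursive n G"
  shows "recursive n (\<lambda>xs. f (G xs))"
proof -
  from assms obtain e d where "\<And>x. rec_eval e [x] (f x)"
    "\<And>xs. length xs = n \<Longrightarrow> rec_eval d xs (G xs)"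
    unfolding computable1_def recursive_def by blast
  then have "rec_eval (Comp e [d]) xs (f (G xs))" if "length xs = n" for xs
    using that by (intro rec_eval_Comp[where ys = "[G xs]"]) auto
  then show ?thesis unfolding recursive_def by blast
qed

lemma computable2_comp:
  assumes "computable2 f" "recursive n G" "recursive n H"
  shows "recursive n (\<lambda>xs. f (G xs) (H xs))"
proof -
  from assms obtain e d c where "\<And>x y. rec_eval e [x, y] (f x y)"
    "\<And>xs. length xs = n \<Longrightarrow> rec_eval d xs (G xs)"
    "\<And>xs. length xs = n \<Longrightarrow> rec_eval c xs (H xs)"
    unfolding computable2_def recursive_def by blast
  then have "rec_eval (Comp e [d, c]) xs (f (G xs) (H xs))" if "length xs = n" for xs
    using that by (intro rec_eval_Comp[where ys = "[G xs, H xs]"]) auto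
  then show ?thesis unfolding recursive_def by blast
qed

lemma computable1I: "recursive 1 (\<lambda>xs. f (xs ! 0)) \<Longrightarrow> computable1 f"
  unfolding recursive_def computable1_def
  by (metis One_nat_def length_Cons list.size(3) nth_Cons_0)

lemma computable2_iff_recursive: "computable2 f \<longleftrightarrow> recursive 2 (\<lambda>xs. f (xs ! 0) (xs ! 1))"
proof
  assume "computable2 f"
  then show "recursive 2 (\<lambda>xs. f (xs ! 0) (xs ! 1))"
    by (rule computable2_comp) (simp_all add: recursive_proj)
next
  assume "recursive 2 (\<lambda>xs. f (xs ! 0) (xs ! 1))"
  then obtain e where e: "\<And>xs. length xs = 2 \<Longrightarrow> rec_eval e xs (f (xs ! 0) (xs ! 1))"
    unfolding recursive_def by blast
  have "rec_eval e [x, y] (f x y)" for x y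
    using e[of "[x, y]"] by simp
  then show "computable2 f" unfolding computable2_def by blast
qed

lemma recursive_zero: "recursive n (\<lambda>xs. 0)"
  unfolding recursive_def by (metis rec_eval_Zero)

lemma recursive_Suc: "recursive n F \<Longrightarrow> recursive n (\<lambda>xs. Suc (F xs))"
  by (rule computable1_comp) (auto simp: computable1_def intro: rec_eval_Succ)

lemma recursive_const: "recursive n (\<lambda>xs. c)"
  by (induction c) (auto intro: recursive_zero recursive_Suc)

lemma recursive_primrec:
  assumes "recursive n G" "recursive (Suc (Suc n)) H"
    and "\<And>xs. length xs = n \<Longrightarrow> F 0 xs = G xs"
    and "\<And>m xs. length xs = n \<Longrightarrow> F (Suc m) xs = H (m # F m xs # xs)"
  shows "recursive (Suc n) (\<lambda>xs. F (hd xs) (tl xs))"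
proof -
  from assms(1,2) obtain g h where
    g: "\<And>xs. length xs = n \<Longrightarrow> rec_eval g xs (G xs)" and
    h: "\<And>xs. length xs = Suc (Suc n) \<Longrightarrow> rec_eval h xs (H xs)"
    unfolding recursive_def by blast
  have "rec_eval (PrimRec g h) (m # xs) (F m xs)" if "length xs = n" for m xs
  proof (induction m)
    case 0
    show ?case using g[OF that] assms(3)[OF that] by (auto intro: rec_eval_PrimRec_0)
  next
    case (Suc m)
    then show ?case using h[of "m # F m xs # xs"] assms(4)[OF that] that
      by (auto intro: rec_eval_PrimRec_Suc)
  qed
  then have "rec_eval (PrimRec g h) xs (F (hd xs) (tl xs))" if "length xs = Suc n" for xs
    using that by (cases xs) auto
  then show ?thesis unfolding recursive_def by blast
qed

text \<open>Primitive recursion without parameters: the start value \<open>f 0\<close> is a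
  constant, hence recursive.\<close>

lemma computable1_primrec:
  assumes "computable2 h" "\<And>m. f (Suc m) = h m (f m)"
  shows "computable1 f"
proof -
  have "recursive (Suc 0) (\<lambda>xs. (\<lambda>m _. f m) (hd xs) (tl xs))"
    by (rule recursive_primrec[where G = "\<lambda>_. f 0" and H = "\<lambda>xs. h (xs ! 0) (xs ! 1)"])
      (auto intro!: recursive_const computable2_comp[OF assms(1)] recursive_proj simp: assms(2))
  then have "recursive 1 (\<lambda>xs. f (xs ! 0))"
    by (auto elim!: recursive_cong simp: length_Suc_conv)
  then show ?thesis by (rule computable1I)
qed

lemma computable2_primrec:
  assumes "computable1 g" "recursive 3 (\<lambda>xs. h (xs ! 0) (xs ! 1) (xs ! 2))"
    and "\<And>x. f x 0 = g x" "\<And>x s. f x (Suc s) = h s (f x s) x"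
  shows "computable2 f"
proof -
  \<comment> \<open>\<open>PrimRec\<close> recurses on its first argument, \<open>f\<close> on its
    second. The function is built with the arguments swapped, and projections swap them back at the
    end.\<close>
  have "recursive (Suc 1) (\<lambda>xs. (\<lambda>m ys. f (ys ! 0) m) (hd xs) (tl xs))"
    by (rule recursive_primrec[where G = "\<lambda>xs. g (xs ! 0)"
          and H = "\<lambda>xs. h (xs ! 0) (xs ! 1) (xs ! 2)"])
      (use assms(2) in \<open>auto intro!: computable1_comp[OF assms(1)] recursive_proj
          simp: assms(3,4) numeral_3_eq_3 numeral_2_eq_2\<close>)
  then have "recursive 2 (\<lambda>xs. f (xs ! 1) (xs ! 0))"
    by (auto elim!: recursive_cong simp: length_Suc_conv numeral_2_eq_2)
  then have "computable2 (\<lambda>s x. f x s)"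
    by (subst computable2_iff_recursive)
  then have "recursive 2 (\<lambda>xs. f (xs ! 0) (xs ! 1))"
    by (rule computable2_comp) (simp_all add: recursive_proj)
  then show ?thesis by (simp add: computable2_iff_recursive)
qed

section \<open>Arithmetic and case distinctions\<close>

lemma recursive_add:
  assumes "recursive n F" "recursive n G"
  shows "recursive n (\<lambda>xs. F xs + G xs)"
proof -
  have "computable2 (+)"
    by (rule computable2_primrec[where g = "\<lambda>x. x" and h = "\<lambda>s r x. Suc r"])
      (auto intro!: computable1I recursive_Suc recursive_proj)
  then show ?thesis using assms by (rule computable2_comp)
qed

lemma recursive_mult:
  assumes "recursive n F" "recursive n G"
  shows "recursive n (\<lambda>xs. F xs * G xs)"
proof -
  have "computable2 (*)"
    by (rule computable2_primrec[where g = "\<lambda>x. 0" and h = "\<lambda>s r x. r + x"])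
      (auto intro!: computable1I recursive_add recursive_proj recursive_zero)
  then show ?thesis using assms by (rule computable2_comp)
qed

lemma recursive_diff:
  assumes "recursive n F" "recursive n G"
  shows "recursive n (\<lambda>xs. F xs - G xs)"
proof -
  have pred: "computable1 (\<lambda>x. x - 1)"
    by (rule computable1_primrec[where h = "\<lambda>m r. m"])
      (auto simp: computable2_iff_recursive intro: recursive_proj)
  have "computable2 (-)"
    by (rule computable2_primrec[where g = "\<lambda>x. x" and h = "\<lambda>s r x. r - 1"])
      (auto intro!: computable1I recursive_proj computable1_comp[OF pred, simplified])
  then show ?thesis using assms by (rule computable2_comp)
qed

lemma recursive_if_zero:
  assumes "recursive n c" "recursive n F" "recursive n G"
  shows "recursive n (\<lambda>xs. if c xs = 0 then F xs else G xs)"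
proof -
  \<comment> \<open>Under truncated subtraction \<open>1 - c xs\<close> is the indicator of
    \<open>c xs = 0\<close>, and \<open>1 - (1 - c xs)\<close> that of its negation.\<close>
  have "recursive n (\<lambda>xs. (1 - c xs) * F xs + (1 - (1 - c xs)) * G xs)"
    by (intro recursive_add recursive_mult recursive_diff recursive_const assms)
  then show ?thesis by (rule recursive_cong) auto
qed

lemma recursive_if_le:
  assumes "recursive n a" "recursive n b" "recursive n F" "recursive n G"
  shows "recursive n (\<lambda>xs. if a xs \<le> b xs then F xs else G xs)"
  using recursive_if_zero[OF recursive_diff[OF assms(1,2)] assms(3,4)] by simp

lemma recursive_if_even:
  assumes "recursive n c" "recursive n F" "recursive n G"
  shows "recursive n (\<lambda>xs. if even (c xs) then F xs else G xs)"
proof -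
  have "computable1 (\<lambda>m. m mod 2)"
    by (rule computable1_primrec[where h = "\<lambda>m r. 1 - r"])
      (auto simp: computable2_iff_recursive mod_Suc intro!: recursive_diff recursive_const recursive_proj)
  from recursive_if_zero[OF computable1_comp[OF this assms(1)] assms(2,3)]
  show ?thesis by (simp add: even_iff_mod_2_eq_zero)
qed

section \<open>Cantor pairing and its projections\<close>

lemma computable1_triangle: "computable1 triangle"
  by (rule computable1_primrec[where h = "\<lambda>m r. r + Suc m"])
    (auto simp: computable2_iff_recursive intro!: recursive_add recursive_Suc recursive_proj)

lemma recursive_prod_encode:
  assumes "recursive n F" "recursive n G"
  shows "recursive n (\<lambda>xs. prod_encode (F xs, G xs))"
  unfolding prod_encode_def
  by (simp, intro recursive_add computable1_comp[OF computable1_triangle] assms)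

text \<open>The index of the antidiagonal on which the pair coded by \<open>z\<close> lies.\<close>

definition diagonal :: "nat \<Rightarrow> nat" where
  "diagonal z = fst (prod_decode z) + snd (prod_decode z)"

lemma diagonal_encode: "diagonal (triangle (a + b) + a) = a + b"
  using prod_encode_inverse[of "(a, b)"] by (simp add: diagonal_def prod_encode_def)

lemma prod_decode_diagonal:
  "fst (prod_decode z) = z - triangle (diagonal z)"
  "snd (prod_decode z) = diagonal z - (z - triangle (diagonal z))"
proof -
  obtain a b where "prod_decode z = (a, b)" by fastforce
  moreover from this have "z = triangle (a + b) + a"
    using prod_decode_inverse[of z] by (simp add: prod_encode_def)
  ultimately show
    "fst (prod_decode z) = z - triangle (diagonal z)"
    "snd (prod_decode z) = diagonal z - (z - triangle (diagonal z))"
    by (auto simp: diagonal_def)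
qed

text \<open>The codes on antidiagonal \<open>d\<close> run from \<open>triangle d\<close> up to just
  below \<open>triangle (Suc d)\<close>, so a single comparison tells whether the next code leaves
  it. This makes \<open>diagonal\<close> primitive recursive, with no search.\<close>

lemma diagonal_Suc:
  "diagonal (Suc z) =
    (if triangle (Suc (diagonal z)) \<le> Suc z then Suc (diagonal z) else diagonal z)"
proof -
  obtain a b where ab: "prod_decode z = (a, b)" by fastforce
  then have z: "z = triangle (a + b) + a"
    using prod_decode_inverse[of z] by (simp add: prod_encode_def)
  show ?thesis
  proof (cases b)
    case 0
    then show ?thesis using z diagonal_encode[of a b] diagonal_encode[of 0 "Suc a"] by simp
  next
    case (Suc b')
    then show ?thesis using z diagonal_encode[of a b] diagonal_encode[of "Suc a" b'] by simp
  qed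
qed

lemma computable1_diagonal: "computable1 diagonal"
  by (rule computable1_primrec[where h =
        "\<lambda>z r. if triangle (Suc r) \<le> Suc z then Suc r else r"])
    (auto simp: computable2_iff_recursive diagonal_Suc simp del: triangle_Suc
      intro!: recursive_if_le recursive_Suc recursive_proj
      computable1_comp[OF computable1_triangle])

lemma recursive_fst_decode:
  assumes "recursive n F"
  shows "recursive n (\<lambda>xs. fst (prod_decode (F xs)))"
  unfolding prod_decode_diagonal
  by (intro recursive_diff assms computable1_comp[OF computable1_triangle]
      computable1_comp[OF computable1_diagonal])

lemma recursive_snd_decode:
  assumes "recursive n F"
  shows "recursive n (\<lambda>xs. snd (prod_decode (F xs)))"
  unfolding prod_decode_diagonal
  by (intro recursive_diff assms computable1_comp[OF computable1_triangle]
      computable1_comp[OF computable1_diagonal])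


section \<open>Computable functions with rational values\<close>

lemma rat_code_decode:
  assumes "0 \<le> (q::rat)"
  shows "q = of_nat (fst (prod_decode (rat_code q))) / of_nat (snd (prod_decode (rat_code q)))"
    "0 < snd (prod_decode (rat_code q))"
    "coprime (fst (prod_decode (rat_code q))) (snd (prod_decode (rat_code q)))"
proof -
  obtain a b where ab: "quotient_of q = (a, b)" by fastforce
  have q: "q = of_int a / of_int b" "b > 0" "coprime a b"
    using quotient_of_div[OF ab] quotient_of_denom_pos[OF ab] quotient_of_coprime[OF ab] by auto
  then have "a \<ge> 0" using assms by (simp add: zero_le_divide_iff)
  have d: "prod_decode (rat_code q) = (nat a, nat b)"
    by (simp add: rat_code_def ab)
  show "q = of_nat (fst (prod_decode (rat_code q))) / of_nat (snd (prod_decode (rat_code q)))"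
    unfolding d using q \<open>a \<ge> 0\<close> by simp
  show "0 < snd (prod_decode (rat_code q))" unfolding d using q by simp
  show "coprime (fst (prod_decode (rat_code q))) (snd (prod_decode (rat_code q)))"
    unfolding d using q \<open>a \<ge> 0\<close> by (simp flip: coprime_int_iff)
qed

text \<open>Cross-multiplication by the positive denominators turns the order of rationals into a
  recursive test on their codes.\<close>

lemma rat_code_le_iff:
  assumes "0 \<le> p" "0 \<le> q"
  shows "p \<le> q \<longleftrightarrow>
    fst (prod_decode (rat_code p)) * snd (prod_decode (rat_code q))
      \<le> fst (prod_decode (rat_code q)) * snd (prod_decode (rat_code p))"
proof -
  obtain a b where ab: "prod_decode (rat_code p) = (a, b)" by fastforce
  obtain c d where cd: "prod_decode (rat_code q) = (c, d)" by fastforce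
  have p: "p = of_nat a / of_nat b" "b > 0" and q: "q = of_nat c / of_nat d" "d > 0"
    using rat_code_decode[OF assms(1)] rat_code_decode[OF assms(2)] ab cd by auto
  have "p \<le> q \<longleftrightarrow> (of_nat (a * d) :: rat) \<le> of_nat (c * b)"
    using p(2) q(2) by (simp add: p(1) q(1) divide_simps mult.commute)
  then show ?thesis by (simp only: ab cd of_nat_le_iff fst_conv snd_conv)
qed

lemma rat_code_one_minus:
  assumes "q \<in> {0..1}"
  shows "rat_code (1 - q) =
    prod_encode (snd (prod_decode (rat_code q)) - fst (prod_decode (rat_code q)),
      snd (prod_decode (rat_code q)))"
proof -
  obtain a b where ab: "prod_decode (rat_code q) = (a, b)" by fastforce
  have q: "q = of_nat a / of_nat b" "b > 0" "coprime a b"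
    using rat_code_decode[of q] assms ab by auto
  have "a \<le> b" using assms q by (simp add: divide_simps)
  have "coprime (int b - int a) (int b)"
    unfolding coprime_iff_gcd_eq_1 gcd_diff2 using q(3) by simp
  moreover have "1 - q = Rat.Fract (int b - int a) (int b)"
    using q by (simp add: Fract_of_int_quotient diff_divide_distrib)
  ultimately have "quotient_of (1 - q) = (int b - int a, int b)"
    using q(2) by (simp add: quotient_of_Fract normalize_stable)
  then show ?thesis using \<open>a \<le> b\<close> unfolding ab by (simp add: rat_code_def nat_diff_distrib)
qed

text \<open>The range condition covers lists of every length, so that the equations for
  \<open>rat_code\<close> can be rewritten unconditionally under the binder
  \<open>xs\<close>.\<close>

definition recursive_unit_rat :: "nat \<Rightarrow> (nat list \<Rightarrow> rat) \<Rightarrow> bool" where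
  "recursive_unit_rat n F \<longleftrightarrow> (\<forall>xs. F xs \<in> {0..1}) \<and> recursive n (\<lambda>xs. rat_code (F xs))"

lemma computable_unit_rat_iff_recursive:
  "computable_unit_rat f \<longleftrightarrow> recursive_unit_rat 2 (\<lambda>xs. f (xs ! 0) (xs ! 1))"
proof -
  have "(\<forall>x s. f x s \<in> {0..1}) \<longleftrightarrow> (\<forall>xs. f (xs ! 0) (xs ! 1) \<in> {0..1})"
    by (metis One_nat_def nth_Cons_0 nth_Cons_Suc)
  then show ?thesis
    unfolding computable_unit_rat_def recursive_unit_rat_def computable2_iff_recursive by simp
qed

lemma recursive_if_rat_le:
  assumes "recursive_unit_rat n P" "recursive_unit_rat n Q" "recursive n F" "recursive n G"
  shows "recursive n (\<lambda>xs. if P xs \<le> Q xs then F xs else G xs)"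
proof -
  have "P xs \<ge> 0" "Q xs \<ge> 0" for xs
    using assms(1,2) by (auto simp: recursive_unit_rat_def)
  note le = rat_code_le_iff[OF this]
  show ?thesis unfolding le
    using assms unfolding recursive_unit_rat_def
    by (intro recursive_if_le recursive_mult recursive_fst_decode recursive_snd_decode) auto
qed

lemma recursive_unit_rat_one_minus:
  assumes "recursive_unit_rat n P"
  shows "recursive_unit_rat n (\<lambda>xs. 1 - P xs)"
proof -
  have "P xs \<in> {0..1}" for xs using assms by (simp add: recursive_unit_rat_def)
  note eq = rat_code_one_minus[OF this]
  show ?thesis
    using assms unfolding recursive_unit_rat_def eq
    by (auto intro!: recursive_prod_encode recursive_diff recursive_fst_decode recursive_snd_decode)
qed

lemma recursive_unit_rat_max:
  assumes "recursive_unit_rat n P" "recursive_unit_rat n Q"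
  shows "recursive_unit_rat n (\<lambda>xs. max (P xs) (Q xs))"
  using recursive_if_rat_le[OF assms, of "\<lambda>xs. rat_code (Q xs)" "\<lambda>xs. rat_code (P xs)"] assms
  by (auto simp: recursive_unit_rat_def max_def if_distrib[of rat_code])

lemma recursive_unit_rat_min:
  assumes "recursive_unit_rat n P" "recursive_unit_rat n Q"
  shows "recursive_unit_rat n (\<lambda>xs. min (P xs) (Q xs))"
  using recursive_if_rat_le[OF assms, of "\<lambda>xs. rat_code (P xs)" "\<lambda>xs. rat_code (Q xs)"] assms
  by (auto simp: recursive_unit_rat_def min_def if_distrib[of rat_code])

lemma recursive_unit_rat_Max:
  assumes "finite I" "I \<noteq> {}" "\<And>i. i \<in> I \<Longrightarrow> recursive_unit_rat n (P i)"
  shows "recursive_unit_rat n (\<lambda>xs. Max ((\<lambda>i. P i xs) ` I))"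
  using assms
proof (induction I rule: finite_ne_induct)
  case (insert i I)
  then show ?case by (simp add: recursive_unit_rat_max)
qed simp

lemma recursive_unit_rat_if_le:
  assumes "recursive n a" "recursive n b" "recursive_unit_rat n P" "recursive_unit_rat n Q"
  shows "recursive_unit_rat n (\<lambda>xs. if a xs \<le> b xs then P xs else Q xs)"
  using assms recursive_if_le[OF assms(1,2), of "\<lambda>xs. rat_code (P xs)" "\<lambda>xs. rat_code (Q xs)"]
  by (auto simp: recursive_unit_rat_def if_distrib[of rat_code])

lemma recursive_unit_rat_const: "q \<in> {0..1} \<Longrightarrow> recursive_unit_rat n (\<lambda>xs. q)"
  by (simp add: recursive_unit_rat_def recursive_const)

lemma computable_unit_rat_comp:
  assumes "computable_unit_rat f" "recursive n G" "recursive n H"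
  shows "recursive_unit_rat n (\<lambda>xs. f (G xs) (H xs))"
  using assms computable2_comp[of "\<lambda>x s. rat_code (f x s)" n G H]
  by (auto simp: recursive_unit_rat_def computable_unit_rat_def)


section \<open>Counting mind changes\<close>

text \<open>One number carries both the count of mind changes and the current direction: even means
  rising (\<open>mind_change\<close> is 1), odd means falling.\<close>

primrec turns :: "(nat \<Rightarrow> rat) \<Rightarrow> nat \<Rightarrow> nat" where
  "turns g 0 = 0"
| "turns g (Suc s) =
    (if even (turns g s)
     then (if g s \<le> g (Suc s) then turns g s else Suc (turns g s))
     else (if g (Suc s) \<le> g s then turns g s else Suc (turns g s)))"

lemma mind_change_turns: "mind_change f x s = (if even (turns (f x) s) then 1 else -1)"
  by (induction s) auto

lemma mind_change_Suc_iff: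
  "mind_change f x (Suc s) \<noteq> mind_change f x s \<longleftrightarrow> turns (f x) (Suc s) \<noteq> turns (f x) s"
  by (simp add: mind_change_turns)

lemma turns_eq_card: "turns g s = card {t. t < s \<and> turns g (Suc t) \<noteq> turns g t}"
proof (induction s)
  case (Suc s)
  let ?T = "\<lambda>s. {t. t < s \<and> turns g (Suc t) \<noteq> turns g t}"
  have "?T (Suc s) = (if turns g (Suc s) \<noteq> turns g s then insert s (?T s) else ?T s)"
    by (auto simp: less_Suc_eq simp del: turns.simps)
  then have "card (?T (Suc s)) =
      (if turns g (Suc s) \<noteq> turns g s then Suc (card (?T s)) else card (?T s))"
    by (simp del: turns.simps)
  also have "\<dots> = turns g (Suc s)"
    unfolding Suc[symmetric] by auto
  finally show ?case by (rule sym)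
qed simp

text \<open>\<open>turns g s\<close> counts the change times below \<open>s\<close>, so bounding all
  these initial counts bounds the whole set and makes it finite.\<close>

lemma turns_le_iff:
  "finite {s. turns g (Suc s) \<noteq> turns g s} \<and> card {s. turns g (Suc s) \<noteq> turns g s} \<le> N
    \<longleftrightarrow> (\<forall>s. turns g s \<le> N)" (is "?L \<longleftrightarrow> ?R")
proof
  assume L: ?L
  show ?R
  proof
    fix s
    have "turns g s \<le> card {s. turns g (Suc s) \<noteq> turns g s}"
      unfolding turns_eq_card[of g s] by (rule card_mono) (use L in auto)
    then show "turns g s \<le> N" using L by linarith
  qed
next
  let ?T = "{s. turns g (Suc s) \<noteq> turns g s}"
  assume R: ?R
  \<comment> \<open>A finite set of change times lies below some stage \<open>s\<close> and is
    therefore counted by \<open>turns g s\<close>. Applied to a subset of size \<open>Suc N\<close>,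
    this also excludes infinitely many changes.\<close>
  have bd: "card F \<le> N" if F: "finite F" "F \<subseteq> ?T" for F
  proof -
    obtain s where s: "\<forall>t\<in>F. t < s" using F(1) finite_nat_set_iff_bounded by blast
    then have "F \<subseteq> {t. t < s \<and> turns g (Suc t) \<noteq> turns g t}" using F(2) by blast
    then have "card F \<le> turns g s"
      unfolding turns_eq_card[of g s] by (intro card_mono) auto
    then show ?thesis using R le_trans by blast
  qed
  have "finite ?T"
  proof (rule ccontr)
    assume "infinite ?T"
    then obtain F where "finite F" "card F = Suc N" "F \<subseteq> ?T"
      using infinite_arbitrarily_large by blast
    then show False using bd[of F] by simp
  qed
  then show ?L using bd by blast
qed

lemma fuzzy_nce_turns:
  "fuzzy_nce n A \<longleftrightarrow> n \<ge> 1 \<and> fuzzy_set A \<and>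
    (\<exists>f. computable_unit_rat f \<and>
      (\<forall>x. (\<lambda>s. real_of_rat (f x s)) \<longlonglongrightarrow> A x \<and> f x 0 = 0 \<and> (\<forall>s. turns (f x) s \<le> n - 1)))"
  unfolding fuzzy_nce_def mind_change_Suc_iff turns_le_iff by blast

lemma turns_mono: "s \<le> t \<Longrightarrow> turns g s \<le> turns g t"
  by (rule lift_Suc_mono_le) auto

lemma turns_eventually_const:
  assumes "\<And>s. turns g s \<le> N"
  obtains M S where "M \<le> N" "\<And>s. s \<ge> S \<Longrightarrow> turns g s = M"
proof -
  have fin: "finite (range (turns g))"
    by (rule finite_subset[of _ "{..N}"]) (use assms in auto)
  then have "Max (range (turns g)) \<in> range (turns g)" by (intro Max_in) auto
  then obtain S where S: "turns g S = Max (range (turns g))" by auto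
  have "turns g s = turns g S" if "s \<ge> S" for s
    using turns_mono[OF that, of g] Max_ge[OF fin, of "turns g s"] S by simp
  then show thesis using that assms by blast
qed

lemma computable2_turns:
  assumes "computable_unit_rat f"
  shows "computable2 (\<lambda>x s. turns (f x) s)"
proof (rule computable2_primrec)
  show "computable1 (\<lambda>x. 0)" by (intro computable1I recursive_const)
  let ?h = "\<lambda>s r x. if even r then (if f x s \<le> f x (Suc s) then r else Suc r)
     else (if f x (Suc s) \<le> f x s then r else Suc r)"
  show "recursive 3 (\<lambda>xs. ?h (xs ! 0) (xs ! 1) (xs ! 2))"
    by (intro recursive_if_even recursive_if_rat_le computable_unit_rat_comp[OF assms]
        recursive_Suc recursive_proj) auto
qed auto


section \<open>Splitting an approximation at its mind changes\<close>

text \<open>The \<open>j\<close>-th monotone piece of \<open>g\<close>, reflected if it is decreasing and continued by 0 to the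
  left and by 1 to the right, so that it increases.\<close>

definition piece :: "nat \<Rightarrow> (nat \<Rightarrow> rat) \<Rightarrow> nat \<Rightarrow> rat" where
  "piece j g s = (if turns g s < j then 0 else if turns g s > j then 1
     else if even j then g s else 1 - g s)"

lemma piece_unit: "g s \<in> {0..1} \<Longrightarrow> piece j g s \<in> {0..1}"
  by (simp add: piece_def)

text \<open>While \<open>turns g\<close> equals \<open>j\<close>, \<open>g\<close> moves in the
  direction given by the parity of \<open>j\<close>. Entering the piece is a step up from 0 and
  leaving it a step up to 1, because all values lie in the unit interval.\<close>

lemma piece_Suc:
  assumes "\<And>s. g s \<in> {0..1}"
  shows "piece j g s \<le> piece j g (Suc s)"
  using assms[of s] assms[of "Suc s"] by (auto simp: piece_def)

lemma computable_unit_rat_piece: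
  assumes "computable_unit_rat f"
  shows "computable_unit_rat (\<lambda>x s. piece j (f x) s)"
proof -
  let ?t = "\<lambda>xs. turns (f (xs ! 0)) (xs ! 1)"
  have f: "recursive_unit_rat 2 (\<lambda>xs. f (xs ! 0) (xs ! 1))"
    using assms by (simp add: computable_unit_rat_iff_recursive)
  have t: "recursive 2 ?t"
    using computable2_turns[OF assms] by (simp add: computable2_iff_recursive)
  have mid: "recursive_unit_rat 2 (\<lambda>xs. if even j then f (xs ! 0) (xs ! 1) else 1 - f (xs ! 0) (xs ! 1))"
    using f recursive_unit_rat_one_minus[OF f] by (cases "even j") auto
  have "recursive_unit_rat 2 (\<lambda>xs. if Suc (?t xs) \<le> j then 0 else if Suc j \<le> ?t xs then 1
      else if even j then f (xs ! 0) (xs ! 1) else 1 - f (xs ! 0) (xs ! 1))"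
    by (intro recursive_unit_rat_if_le recursive_unit_rat_const recursive_const recursive_Suc t mid) auto
  then show ?thesis
    by (simp add: computable_unit_rat_iff_recursive piece_def Suc_le_eq cong: if_cong)
qed

definition piece_limit :: "nat \<Rightarrow> (nat \<Rightarrow> rat) \<Rightarrow> real" where
  "piece_limit j g = lim (\<lambda>s. real_of_rat (piece j g s))"

text \<open>Monotone convergence; it ensures that \<open>lim\<close> in \<open>piece_limit\<close>
  denotes a genuine limit.\<close>

lemma piece_limit_tendsto:
  assumes "\<And>s. g s \<in> {0..1}"
  shows "(\<lambda>s. real_of_rat (piece j g s)) \<longlonglongrightarrow> piece_limit j g"
proof -
  have "incseq (\<lambda>s. real_of_rat (piece j g s))"
    by (intro incseq_SucI) (simp add: of_rat_less_eq piece_Suc[OF assms])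
  moreover have "real_of_rat (piece j g s) \<le> 1" for s
    using piece_unit[where g = g and s = s, OF assms] by simp
  ultimately have "convergent (\<lambda>s. real_of_rat (piece j g s))"
    by (meson incseq_convergent convergentI)
  then show ?thesis by (simp add: piece_limit_def convergent_LIMSEQ_iff)
qed

lemma fuzzy_ce_piece_limit:
  assumes "computable_unit_rat f"
  shows "fuzzy_ce (\<lambda>x. piece_limit j (f x))"
proof -
  have f: "f x s \<in> {0..1}" for x s using assms by (simp add: computable_unit_rat_def)
  note lims = piece_limit_tendsto[of "f _", OF f]
  have "piece_limit j (f x) \<in> {0..1}" for x
  proof -
    have "real_of_rat (piece j (f x) s) \<in> {0..1}" for s
      using piece_unit[where g = "f x" and s = s, OF f] by simp
    then show ?thesis
      using LIMSEQ_le_const[OF lims, of 0] LIMSEQ_le_const2[OF lims, of _ _ 1] by auto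
  qed
  then show ?thesis
    unfolding fuzzy_ce_def fuzzy_set_def
    using computable_unit_rat_piece[OF assms] lims piece_Suc[of "f _", OF f] by blast
qed

text \<open>From stage \<open>S\<close> on, \<open>g\<close> remains in phase \<open>M\<close>:
  earlier pieces have reached 1, later ones are still 0, and piece \<open>M\<close> follows
  \<open>g\<close> or \<open>1 - g\<close>.\<close>

lemma piece_limit_eq:
  assumes "\<And>s. g s \<in> {0..1}" "(\<lambda>s. real_of_rat (g s)) \<longlonglongrightarrow> c" "\<And>s. s \<ge> S \<Longrightarrow> turns g s = M"
  shows "piece_limit j g = (if M < j then 0 else if M > j then 1 else if even j then c else 1 - c)"
proof -
  let ?r = "\<lambda>s. if M < j then 0 else if M > j then 1 else
    if even j then real_of_rat (g s) else 1 - real_of_rat (g s)"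
  have "eventually (\<lambda>s. ?r s = real_of_rat (piece j g s)) sequentially"
    unfolding eventually_sequentially
    by (rule exI[of _ S]) (auto simp: piece_def assms(3) of_rat_diff)
  moreover have "?r \<longlonglongrightarrow> (if M < j then 0 else if M > j then 1 else if even j then c else 1 - c)"
    using assms(2) by (auto intro!: tendsto_intros)
  ultimately have "(\<lambda>s. real_of_rat (piece j g s)) \<longlonglongrightarrow>
      (if M < j then 0 else if M > j then 1 else if even j then c else 1 - c)"
    by (rule Lim_transform_eventually[rotated])
  then show ?thesis by (rule LIMSEQ_unique[OF piece_limit_tendsto[OF assms(1)]])
qed

section \<open>From a bounded number of mind changes to a union\<close>

lemma nce_imp_union:
  assumes n: "n \<in> {2 * k + 1, 2 * k + 2}" and "fuzzy_nce n C"
  shows "\<exists>A B :: nat \<Rightarrow> nat \<Rightarrow> real.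
      (\<forall>i\<in>{1..k + 1}. fuzzy_ce (A i) \<and> fuzzy_ce (B i)) \<and>
      C = fuzzy_Union {1..k + 1} (\<lambda>i. fuzzy_inter (A i) (fuzzy_compl (B i))) \<and>
      (n = 2 * k + 1 \<longrightarrow> B (k + 1) = fuzzy_empty)"
proof -
  from assms(2) obtain f where C: "\<And>x. C x \<in> {0..1}" and f: "computable_unit_rat f"
    and lim: "\<And>x. (\<lambda>s. real_of_rat (f x s)) \<longlonglongrightarrow> C x" and t: "\<And>x s. turns (f x) s \<le> n - 1"
    unfolding fuzzy_nce_turns fuzzy_set_def by blast
  have unit: "f x s \<in> {0..1}" for x s using f by (simp add: computable_unit_rat_def)
  \<comment> \<open>Pairs are numbered from 1 but phases from 0: pair \<open>i\<close> owns the
    rising phase \<open>2 * (i - 1)\<close> and the falling phase after it.\<close>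
  define A where "A i x = piece_limit (2 * (i - 1)) (f x)" for i x
  define B where "B i x = piece_limit (2 * (i - 1) + 1) (f x)" for i x
  have ce: "fuzzy_ce (A i)" "fuzzy_ce (B i)" for i
    unfolding A_def[abs_def] B_def[abs_def] by (rule fuzzy_ce_piece_limit[OF f])+
  have "C x = Max ((\<lambda>i. min (A i x) (1 - B i x)) ` {1..k + 1})
    \<and> (n = 2 * k + 1 \<longrightarrow> B (k + 1) x = 0)" for x
  proof -
    obtain M S where M: "M \<le> n - 1" and S: "\<And>s. s \<ge> S \<Longrightarrow> turns (f x) s = M"
      using turns_eventually_const[of "f x", OF t] by blast
    note pl = piece_limit_eq[of "f x", OF unit lim S]
    have D: "min (A i x) (1 - B i x) = (if i = M div 2 + 1 then C x else 0)" if "i \<ge> 1" for i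
    proof -
      obtain j where i: "i = Suc j" using \<open>i \<ge> 1\<close> by (cases i) auto
      \<comment> \<open>In this order the limits of the pair \<open>A i x\<close>,
        \<open>B i x\<close> are 0 and 0; \<open>C x\<close> and 0; 1 and \<open>1 - C x\<close>; 1
        and 1.\<close>
      consider "M < 2 * j" | "M = 2 * j" | "M = 2 * j + 1" | "M > 2 * j + 1" by linarith
      then show ?thesis
        using C[of x] by cases (auto simp: i A_def B_def pl)
    qed
    have "Max ((\<lambda>i. min (A i x) (1 - B i x)) ` {1..k + 1}) = C x"
    proof (rule Max_eqI)
      show "y \<le> C x" if "y \<in> (\<lambda>i. min (A i x) (1 - B i x)) ` {1..k + 1}" for y
        using that D C[of x] by auto
      have "M div 2 + 1 \<in> {1..k + 1}" using M n by auto
      then show "C x \<in> (\<lambda>i. min (A i x) (1 - B i x)) ` {1..k + 1}"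
        using D by (intro image_eqI[of _ _ "M div 2 + 1"]) auto
    qed simp
    \<comment> \<open>Here \<open>M \<le> 2 * k\<close>, so the last falling phase, number
      \<open>2 * k + 1\<close>, never starts.\<close>
    moreover have "n = 2 * k + 1 \<longrightarrow> B (k + 1) x = 0"
      using M by (auto simp: B_def pl)
    ultimately show ?thesis by simp
  qed
  then have "C = fuzzy_Union {1..k + 1} (\<lambda>i. fuzzy_inter (A i) (fuzzy_compl (B i)))"
    "n = 2 * k + 1 \<longrightarrow> B (k + 1) = fuzzy_empty"
    unfolding fuzzy_Union_def fuzzy_inter_def fuzzy_compl_def fuzzy_empty_def by blast+
  with ce show ?thesis by (intro exI[of _ A] exI[of _ B]) simp
qed


section \<open>Mind changes of a maximum of quasi-concave sequences\<close>

definition quasi_concave :: "(nat \<Rightarrow> rat) \<Rightarrow> bool" where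
  "quasi_concave d \<longleftrightarrow> (\<forall>t v s. t \<le> v \<longrightarrow> v \<le> s \<longrightarrow> min (d t) (d s) \<le> d v)"

text \<open>Between \<open>t\<close> and \<open>s\<close> the rising part is at least
  \<open>a t\<close> and the falling part at least \<open>b s\<close>.\<close>

lemma quasi_concave_min:
  assumes "incseq a" "decseq b"
  shows "quasi_concave (\<lambda>s. min (a s) (b s))"
  unfolding quasi_concave_def
proof (intro allI impI)
  fix t v s :: nat assume "t \<le> v" "v \<le> s"
  then have "a t \<le> a v" "b s \<le> b v" using assms by (auto dest: incseqD decseqD)
  then show "min (min (a t) (b t)) (min (a s) (b s)) \<le> min (a v) (b v)"
    by (auto simp: min_def)
qed

definition descending :: "'i set \<Rightarrow> ('i \<Rightarrow> nat \<Rightarrow> rat) \<Rightarrow> nat \<Rightarrow> 'i set" where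
  "descending I D s = {i \<in> I. \<exists>t<s. D i t > D i s}"

context
  fixes I :: "'i set" and D :: "'i \<Rightarrow> nat \<Rightarrow> rat" and g :: "nat \<Rightarrow> rat"
  assumes fin: "finite I" and ne: "I \<noteq> {}"
    and qc: "\<And>i. i \<in> I \<Longrightarrow> quasi_concave (D i)"
    and g: "\<And>s. g s = Max ((\<lambda>i. D i s) ` I)"
begin

lemma le_maximum: "i \<in> I \<Longrightarrow> D i s \<le> g s"
  using fin by (simp add: g)

lemma maximum_attained: obtains i where "i \<in> I" "D i s = g s"
proof -
  have "g s \<in> (\<lambda>i. D i s) ` I" unfolding g by (rule Max_in) (use fin ne in auto)
  then show thesis using that by auto
qed

lemma finite_descending: "finite (descending I D s)"
  using fin by (simp add: descending_def)

text \<open>Once \<open>D i s < D i t\<close> with \<open>t < s\<close>, quasi-concavity forces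
  \<open>D i (Suc s) \<le> D i s\<close>: a descent is never reversed.\<close>

lemma descending_Suc: "descending I D s \<subseteq> descending I D (Suc s)"
proof
  fix i assume "i \<in> descending I D s"
  then obtain t where t: "i \<in> I" "t < s" "D i t > D i s" by (auto simp: descending_def)
  have "min (D i t) (D i (Suc s)) \<le> D i s"
    using qc[OF t(1)] t(2) by (simp add: quasi_concave_def)
  then have "D i (Suc s) < D i t" using t(3) by (auto simp: min_def split: if_splits)
  then show "i \<in> descending I D (Suc s)" using t by (auto simp: descending_def intro: less_SucI)
qed

text \<open>To be rising at \<open>s\<close> and still below an earlier value, \<open>g\<close> must
  have turned upward in between; the point where it last did so is the valley.\<close>

lemma valley_before_rise:
  "even (turns g s) \<Longrightarrow> t \<le> s \<Longrightarrow> g s < g t \<Longrightarrow> \<exists>v. t \<le> v \<and> v \<le> s \<and> g v < g s"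
proof (induction s)
  case (Suc s)
  then have "t \<le> s" by (metis le_Suc_eq less_irrefl)
  show ?case
  proof (cases "even (turns g s)")
    case True
    then have "g s \<le> g (Suc s)" using Suc.prems(1) by (auto split: if_splits)
    then show ?thesis
      using Suc.IH[OF True \<open>t \<le> s\<close>] Suc.prems(3)
      by (meson le_SucI order.strict_trans1 order.strict_trans2)
  next
    case False
    \<comment> \<open>The rise begins with this very step, so \<open>s\<close> itself is the
      valley.\<close>
    then have "g s < g (Suc s)" using Suc.prems(1) by (auto split: if_splits)
    then show ?thesis using \<open>t \<le> s\<close> by auto
  qed
qed simp

text \<open>If \<open>D i\<close> had been higher at some \<open>t < s\<close>, so had
  \<open>g\<close>, and there would be a valley \<open>v\<close> of \<open>g\<close> below
  \<open>g s\<close> in between. Then \<open>D i v \<le> g v\<close> lies below both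
  \<open>D i t\<close> and \<open>D i s\<close>, against quasi-concavity.\<close>

lemma attained_not_descending:
  assumes "even (turns g s)" "i \<in> I" "D i s = g s"
  shows "i \<notin> descending I D s"
proof
  assume "i \<in> descending I D s"
  then obtain t where t: "t < s" "D i t > g s" using assms(3) by (auto simp: descending_def)
  then have "g s < g t" using le_maximum[OF assms(2), of t] by simp
  then obtain v where v: "t \<le> v" "v \<le> s" "g v < g s"
    using valley_before_rise[OF assms(1)] t(1) by (meson less_imp_le)
  have "min (D i t) (D i s) \<le> D i v"
    using qc[OF assms(2)] v by (simp add: quasi_concave_def)
  then show False
    using le_maximum[OF assms(2), of v] v(3) t(2) assms(3) by (auto simp: min_def split: if_splits)
qed

text \<open>Every downward turn adds an index to \<open>descending\<close> and so pays for two
  turns. The parity term books the following upward turn in advance: the left side grows by 2 at a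
  downward turn and is unchanged at an upward one.\<close>

lemma turns_le_descending:
  "turns g s + (if even (turns g s) then 0 else 1) \<le> 2 * card (descending I D s)"
proof (induction s)
  case (Suc s)
  have mono: "card (descending I D s) \<le> card (descending I D (Suc s))"
    by (rule card_mono[OF finite_descending descending_Suc])
  show ?case
  proof (cases "even (turns g s) \<and> g (Suc s) < g s")
    case True
    \<comment> \<open>An index attaining the maximum at \<open>s\<close> has to fall along with
      \<open>g\<close>, and it was not descending before.\<close>
    obtain i where i: "i \<in> I" "D i s = g s" by (rule maximum_attained)
    have "D i (Suc s) < D i s" using le_maximum[OF i(1), of "Suc s"] i(2) True by simp
    then have "i \<in> descending I D (Suc s)" using i(1) by (auto simp: descending_def)
    moreover have "i \<notin> descending I D s"
      using attained_not_descending[OF _ i] True by simp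
    ultimately have "descending I D s \<subset> descending I D (Suc s)" using descending_Suc by blast
    then have "card (descending I D s) < card (descending I D (Suc s))"
      by (rule psubset_card_mono[OF finite_descending])
    then show ?thesis using Suc True by simp
  next
    case False
    then show ?thesis using Suc mono by (auto split: if_splits)
  qed
qed simp

text \<open>In a rising phase the index attaining the maximum is missing from
  \<open>descending\<close>; in a falling phase the parity term accounts for the subtracted
  1.\<close>

lemma turns_maximum_le: "turns g s \<le> 2 * card I - 1"
proof (cases "even (turns g s)")
  case True
  obtain i where i: "i \<in> I" "D i s = g s" by (rule maximum_attained)
  then have "descending I D s \<subset> I"
    using attained_not_descending[OF True i] unfolding descending_def by blast
  then have "card (descending I D s) < card I" by (rule psubset_card_mono[OF fin])
  then show ?thesis using turns_le_descending[of s] True by simp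
next
  case False
  have "card (descending I D s) \<le> card I"
    by (rule card_mono[OF fin]) (auto simp: descending_def)
  then show ?thesis using turns_le_descending[of s] False by simp
qed

text \<open>An increasing term never descends, which leaves one index fewer to pay for turns. This
  serves the odd case, where the last \<open>B\<close> is empty.\<close>

lemma turns_maximum_le_if_incseq:
  assumes "j \<in> I" "incseq (D j)"
  shows "turns g s \<le> 2 * (card I - 1)"
proof -
  have "D j t \<le> D j s" if "t < s" for t
    using incseqD[OF assms(2), of t s] that by simp
  then have "j \<notin> descending I D s"
    unfolding descending_def by (auto simp: not_less[symmetric] simp del: not_less)
  then have "descending I D s \<subseteq> I - {j}" by (auto simp: descending_def)
  then have "card (descending I D s) \<le> card (I - {j})" by (rule card_mono[rotated]) (simp add: fin)
  then show ?thesis using turns_le_descending[of s] assms(1) by simp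
qed

end

section \<open>Limits of finite maxima, and from a union to a bounded number of mind changes\<close>

lemma tendsto_Max:
  fixes F :: "'i \<Rightarrow> nat \<Rightarrow> real"
  assumes "finite I" "I \<noteq> {}" "\<And>i. i \<in> I \<Longrightarrow> F i \<longlonglongrightarrow> L i"
  shows "(\<lambda>s. Max ((\<lambda>i. F i s) ` I)) \<longlonglongrightarrow> Max (L ` I)"
  using assms
proof (induction I rule: finite_ne_induct)
  case (insert i I)
  then show ?case by (simp add: tendsto_max)
qed simp

lemma of_rat_Max:
  assumes "finite I" "I \<noteq> {}"
  shows "real_of_rat (Max (h ` I)) = Max ((\<lambda>i. real_of_rat (h i)) ` I)"
  using mono_Max_commute[of real_of_rat "h ` I"] assms
  by (simp add: image_image monoI of_rat_less_eq)

lemma union_imp_nce: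
  assumes n: "n \<in> {2 * k + 1, 2 * k + 2}" and "fuzzy_set C"
    and ce: "\<forall>i\<in>{1..k + 1}. fuzzy_ce (A i) \<and> fuzzy_ce (B i)"
    and C: "C = fuzzy_Union {1..k + 1} (\<lambda>i. fuzzy_inter (A i) (fuzzy_compl (B i)))"
    and empty: "n = 2 * k + 1 \<longrightarrow> B (k + 1) = fuzzy_empty"
  shows "fuzzy_nce n C"
proof -
  let ?I = "{1..k + 1}"
  have "\<forall>i\<in>?I. \<exists>a. computable_unit_rat a \<and>
      (\<forall>x. (\<lambda>s. real_of_rat (a x s)) \<longlonglongrightarrow> A i x) \<and> (\<forall>x. incseq (a x))"
    using ce unfolding fuzzy_ce_def incseq_Suc_iff by blast
  then obtain a where a: "\<And>i. i \<in> ?I \<Longrightarrow> computable_unit_rat (a i)"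
    "\<And>i x. i \<in> ?I \<Longrightarrow> (\<lambda>s. real_of_rat (a i x s)) \<longlonglongrightarrow> A i x"
    "\<And>i x. i \<in> ?I \<Longrightarrow> incseq (a i x)"
    by metis
  have "\<forall>i\<in>?I. \<exists>b. computable_unit_rat b \<and>
      (\<forall>x. (\<lambda>s. real_of_rat (b x s)) \<longlonglongrightarrow> B i x) \<and> (\<forall>x. incseq (b x))"
    using ce unfolding fuzzy_ce_def incseq_Suc_iff by blast
  then obtain b where b: "\<And>i. i \<in> ?I \<Longrightarrow> computable_unit_rat (b i)"
    "\<And>i x. i \<in> ?I \<Longrightarrow> (\<lambda>s. real_of_rat (b i x s)) \<longlonglongrightarrow> B i x"
    "\<And>i x. i \<in> ?I \<Longrightarrow> incseq (b i x)"
    by metis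
  have unit: "a i x s \<in> {0..1}" "b i x s \<in> {0..1}" if "i \<in> ?I" for i x s
    using a(1)[OF that] b(1)[OF that] by (auto simp: computable_unit_rat_def)
  \<comment> \<open>A fuzzy c.e. approximation may start above 0, whereas \<open>f x 0 = 0\<close>
    is required. Resetting stage 0 preserves monotonicity, since \<open>a\<close> is nonnegative,
    and also the limit.\<close>
  define a' where "a' i x s = (if s = 0 then 0 else a i x s)" for i x s
  define D where "D i x s = min (a' i x s) (1 - b i x s)" for i x s
  define f where "f x s = Max ((\<lambda>i. D i x s) ` ?I)" for x s
  have inc: "incseq (a' i x)" if "i \<in> ?I" for i x
    using a(3)[OF that] unit(1)[OF that] by (auto simp: a'_def incseq_def)
  have dec: "decseq (\<lambda>s. 1 - b i x s)" if "i \<in> ?I" for i x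
    using b(3)[OF that, of x] by (auto simp: incseq_def decseq_def)
  have qc: "quasi_concave (D i x)" if "i \<in> ?I" for i x
    unfolding D_def by (rule quasi_concave_min[OF inc[OF that] dec[OF that]])
  have "recursive_unit_rat 2 (\<lambda>xs. D i (xs ! 0) (xs ! 1))" if "i \<in> ?I" for i
  proof -
    have "recursive_unit_rat 2 (\<lambda>xs. min
        (if xs ! 1 \<le> 0 then 0 else a i (xs ! 0) (xs ! 1)) (1 - b i (xs ! 0) (xs ! 1)))"
      using a(1)[OF that] b(1)[OF that]
      by (auto simp: computable_unit_rat_iff_recursive intro!: recursive_unit_rat_min
          recursive_unit_rat_if_le[where b = "\<lambda>_. 0", simplified]
          recursive_unit_rat_one_minus recursive_unit_rat_const recursive_const recursive_proj)
    then show ?thesis by (simp add: D_def a'_def cong: if_cong)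
  qed
  then have comp: "computable_unit_rat f"
    unfolding computable_unit_rat_iff_recursive f_def by (intro recursive_unit_rat_Max) auto
  have zero: "f x 0 = 0" for x
  proof -
    have "D i x 0 = 0" if "i \<in> ?I" for i
      using unit(2)[OF that, of x 0] by (simp add: D_def a'_def)
    then have "(\<lambda>i. D i x 0) ` ?I = {0}" by force
    then show ?thesis by (simp add: f_def)
  qed
  have lim: "(\<lambda>s. real_of_rat (f x s)) \<longlonglongrightarrow> C x" for x
  proof -
    have "(\<lambda>s. real_of_rat (D i x s)) \<longlonglongrightarrow> min (A i x) (1 - B i x)" if "i \<in> ?I" for i
    proof -
      have "(\<lambda>s. min (real_of_rat (a i x s)) (1 - real_of_rat (b i x s))) \<longlonglongrightarrow> min (A i x) (1 - B i x)"
        using a(2)[OF that] b(2)[OF that] by (intro tendsto_intros)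
      moreover have "eventually (\<lambda>s. min (real_of_rat (a i x s)) (1 - real_of_rat (b i x s))
          = real_of_rat (D i x s)) sequentially"
        using eventually_gt_at_top[of 0]
      proof eventually_elim
        case (elim s)
        have "real_of_rat (min p (1 - q)) = min (real_of_rat p) (1 - real_of_rat q)" for p q
          using of_rat_less_eq[of p "1 - q", where 'a = real] by (auto simp: min_def of_rat_diff)
        then show ?case using elim by (simp add: D_def a'_def)
      qed
      ultimately show ?thesis by (rule Lim_transform_eventually)
    qed
    then show ?thesis
      unfolding C f_def fuzzy_Union_def fuzzy_inter_def fuzzy_compl_def
      by (subst of_rat_Max) (auto intro!: tendsto_Max)
  qed
  have "turns (f x) s \<le> n - 1" for x s
  proof (cases "n = 2 * k + 1")
    case True
    have k1: "k + 1 \<in> ?I" by simp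
    \<comment> \<open>An increasing sequence stays below its limit, here 0, so
      \<open>b (k + 1) x\<close> vanishes at every stage and the last term reduces to the increasing
      \<open>a' (k + 1) x\<close>.\<close>
    have "real_of_rat (b (k + 1) x s) \<le> 0" for s
      using incseq_le[OF _ b(2)[OF k1, of x], of s] b(3)[OF k1, of x] empty True
      by (simp add: fuzzy_empty_def incseq_def of_rat_less_eq)
    then have "b (k + 1) x s = 0" for s
      using unit(2)[OF k1, of x s] by (metis antisym atLeastAtMost_iff of_rat_le_0_iff)
    moreover have "a' (k + 1) x s \<le> 1" for s using unit(1)[OF k1] by (simp add: a'_def)
    ultimately have "D (k + 1) x = a' (k + 1) x" by (auto simp: D_def min_def)
    then have "incseq (D (k + 1) x)" using inc[OF k1] by simp
    from turns_maximum_le_if_incseq[of ?I "\<lambda>i. D i x" "f x", OF _ _ qc f_def k1 this]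
    show ?thesis using True by simp
  next
    case False
    \<comment> \<open>The index set has \<open>k + 1\<close> elements, and
      \<open>2 * (k + 1) - 1 = n - 1\<close> for \<open>n = 2 * k + 2\<close>.\<close>
    then show ?thesis
      using turns_maximum_le[of ?I "\<lambda>i. D i x" "f x" s, OF _ _ qc f_def] n by simp
  qed
  then show ?thesis
    unfolding fuzzy_nce_turns using n assms(2) comp lim zero by auto
qed

theorem theorem2:
  fixes k n :: nat and C :: "nat \<Rightarrow> real"
  assumes "n \<in> {2 * k + 1, 2 * k + 2}" and "fuzzy_set C"
  shows "fuzzy_nce n C \<longleftrightarrow>
    (\<exists>A B :: nat \<Rightarrow> nat \<Rightarrow> real.
      (\<forall>i\<in>{1..k + 1}. fuzzy_ce (A i) \<and> fuzzy_ce (B i)) \<and>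
      C = fuzzy_Union {1..k + 1} (\<lambda>i. fuzzy_inter (A i) (fuzzy_compl (B i))) \<and>
      (n = 2 * k + 1 \<longrightarrow> B (k + 1) = fuzzy_empty))"
  using nce_imp_union[OF assms(1)] union_imp_nce[OF assms] by blast

end
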